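(* Let $p$ be an odd prime. (1) Let $p\equiv 9\pmod{16}$. If $\left(\frac{2}{p}\right)_4=-1$, then $x^2-2py^2=-1$ has a solution $(x,y)\in\mathbb{Z}^2$. If $\left(\frac{2}{p}\right)_4=1$, then $x^2-2py^2=-2$ has a solution $(x,y)\in\mathbb{Z}^2$. (2) Let $p\equiv 1\pmod{16}$. If $\left(\frac{2}{p}\right)_4=-1$, then $x^2-2py^2=2$ has a solution $(x,y)\in\mathbb{Z}^2$.
   Context: For a prime $p\equiv 1\pmod 8$ (so that $2$ is a square modulo $p$), $\left(\frac{2}{p}\right)_4\in\{\pm1\}$ is $1$ if $2$ is a fourth power modulo $p$ and $-1$ otherwise. *)

theory Defs
  imports "HOL-Number_Theory.Number_Theory"
begin

text \<open>
  The symbol \<open>(2/p)\<^sub>4\<close>. It is meaningful only for primes \<open>p\<close> with \<open>p mod 8 = 1\<close>, where \<open>2\<close> is a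
  square modulo \<open>p\<close>; for other \<open>p\<close> the value below carries no meaning.
\<close>

definition quartic_symbol_2 :: "nat \<Rightarrow> int" where
  "quartic_symbol_2 p = (if \<exists>a::int. [a ^ 4 = 2] (mod int p) then 1 else -1)"

end

theory Submission
  imports Defs "HOL-Computational_Algebra.Nth_Powers"
    "HOL-Analysis.Kronecker_Approximation_Theorem"
begin

text \<open>
  For every odd prime \<open>p\<close>, a descent on the least solution of \<open>x\<^sup>2 - 2 p y\<^sup>2 = 1\<close> shows that
  at least one of the three equations

  \<^item> \<open>a\<^sup>2 - 2 p b\<^sup>2 = -1\<close>,
  \<^item> \<open>2 a\<^sup>2 - p b\<^sup>2 = 1\<close>, equivalently \<open>(2 a)\<^sup>2 - 2 p b\<^sup>2 = 2\<close>,
  \<^item> \<open>2 a\<^sup>2 - p b\<^sup>2 = -1\<close>, equivalently \<open>(2 a)\<^sup>2 - 2 p b\<^sup>2 = -2\<close>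

  is solvable in integers (\<open>Pell_2_prime_trichotomy\<close>). For \<open>p \<equiv> 1 (mod 8)\<close> each of them forces
  a condition on \<open>p\<close>, and in each case of the theorem two of the three conditions fail, so that
  the remaining equation must be the solvable one. The conditions are, in the same order:

  \<^item> \<open>(2/p)\<^sub>4 = (-1)\<^bsup>(p-1)/8\<^esup>\<close>. Here \<open>a\<^sup>2 \<equiv> -1\<close>, hence \<open>(a + 1)\<^sup>2 \<equiv> 2 a (mod p)\<close>; raising this to the
    power \<open>(p-1)/4\<close> expresses \<open>(2/p)\<^sub>4\<close> through \<open>((a + 1)/p)\<close> and a power of \<open>-1\<close>.
  \<^item> \<open>p \<equiv> 1 (mod 16)\<close>. Here \<open>2\<close> is a square modulo every prime divisor of \<open>b\<close>, so
    \<open>b \<equiv> \<plusminus>1 (mod 8)\<close> and \<open>b\<^sup>2 \<equiv> 1 (mod 16)\<close>, and the equation can be read modulo \<open>16\<close>.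
  \<^item> \<open>(2/p)\<^sub>4 = 1\<close>. Here \<open>2 a\<^sup>2 \<equiv> -1 (mod p)\<close>, which expresses \<open>(2/p)\<^sub>4\<close> through \<open>(a/p)\<close>, because \<open>-1\<close> is
    a fourth power modulo \<open>p\<close>.

  The Legendre symbols that occur in the first and third case are equal to \<open>1\<close> for one and the same
  reason (\<open>Legendre_divisor_eq_1\<close>): up to a factor \<open>2\<close>, their numerators divide a number of the form
  \<open>p b\<^sup>2 - z\<^sup>2\<close> with \<open>z\<close> coprime to the divisor, so \<open>p\<close> is a square modulo their odd prime factors, and quadratic reciprocity applies to each of these.
\<close>

section \<open>Pell's equation\<close>

text \<open>
  The norm \<open>h\<^sup>2 - d k\<^sup>2\<close> is the product of \<open>h - k \<surd>d\<close>, which is below \<open>1/k\<close> in absolute value, and \<open>h + k \<surd>d\<close>,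
  which differs from \<open>2 k \<surd>d\<close> by the first factor.
\<close>
lemma norm_of_approximation_le:
  assumes "(h, k) \<in> approx_set (sqrt d)" "0 \<le> d"
  shows "\<bar>(real_of_int h)\<^sup>2 - d * (real_of_int k)\<^sup>2\<bar> \<le> 1 + 2 * sqrt d"
proof -
  define \<delta> where "\<delta> = h - k * sqrt d"
  have k: "k > 0" and "\<bar>sqrt d - h / k\<bar> < 1 / (real_of_int k)\<^sup>2"
    using assms by (auto simp: approx_set_def)
  then have "k * \<bar>sqrt d - h / k\<bar> < k * (1 / (real_of_int k)\<^sup>2)"
    by (intro mult_strict_left_mono) auto
  also have "k * (1 / (real_of_int k)\<^sup>2) = 1 / k"
    using k by (simp add: power2_eq_square)
  also have "k * \<bar>sqrt d - h / k\<bar> = \<bar>k * (sqrt d - h / k)\<bar>"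
    using k by (simp add: abs_mult)
  also have "k * (sqrt d - h / k) = - \<delta>"
    using k by (simp add: \<delta>_def field_simps)
  finally have \<delta>: "\<bar>\<delta>\<bar> < 1 / k" by simp
  have "1 / real_of_int k \<le> 1" using k by simp
  with \<delta> have "\<bar>\<delta>\<bar> * \<bar>\<delta>\<bar> \<le> 1 * 1" by (intro mult_mono) auto
  moreover have "\<bar>\<delta>\<bar> * k \<le> 1"
    using \<delta> k by (simp add: field_simps)
  then have "\<bar>\<delta>\<bar> * k * (2 * sqrt d) \<le> 1 * (2 * sqrt d)"
    using assms(2) by (intro mult_right_mono) auto
  moreover have "\<bar>(real_of_int h)\<^sup>2 - d * (real_of_int k)\<^sup>2\<bar> = \<bar>\<delta> * \<delta> + \<delta> * k * (2 * sqrt d)\<bar>"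
  proof -
    have "sqrt d * sqrt d = d" using assms(2) by simp
    then have "(real_of_int h)\<^sup>2 - d * (real_of_int k)\<^sup>2 = (h - k * sqrt d) * (h + k * sqrt d)"
      by (simp add: power2_eq_square algebra_simps)
    also have "\<dots> = \<delta> * \<delta> + \<delta> * k * (2 * sqrt d)"
      by (simp add: \<delta>_def algebra_simps)
    finally show ?thesis by simp
  qed
  moreover have "\<bar>\<delta> * \<delta> + \<delta> * k * (2 * sqrt d)\<bar> \<le> \<bar>\<delta> * \<delta>\<bar> + \<bar>\<delta> * k * (2 * sqrt d)\<bar>"
    by (rule abs_triangle_ineq)
  moreover have "\<bar>\<delta> * k * (2 * sqrt d)\<bar> = \<bar>\<delta>\<bar> * k * (2 * sqrt d)"
    using k assms(2) by (simp add: abs_mult)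
  moreover have "\<bar>\<delta> * \<delta>\<bar> = \<bar>\<delta>\<bar> * \<bar>\<delta>\<bar>" by (rule abs_mult)
  ultimately show ?thesis by linarith
qed

text \<open>
  Lagrange's argument. The infinitely many good approximations \<open>h/k\<close> of \<open>\<surd>d\<close> have bounded norms, so
  infinitely many of them share a norm \<open>m\<close>, and two of these agree modulo \<open>m\<close> in both coordinates.
  The quotient of \<open>h + k \<surd>d\<close> and \<open>h' + k' \<surd>d\<close> is then an integral element of norm \<open>1\<close>. It is not
  \<open>\<plusminus>1\<close>, since the approximations are in lowest terms.
\<close>
theorem Pell_nontrivial_solution:
  fixes d :: nat
  assumes irr: "sqrt d \<notin> \<rat>"
  obtains x y :: int where "y \<noteq> 0" "x\<^sup>2 - int d * y\<^sup>2 = 1"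
proof -
  define S where "S = approx_set (sqrt d)"
  define N where "N = (\<lambda>(h :: int, k :: int). h\<^sup>2 - int d * k\<^sup>2)"
  define M where "M = \<lceil>1 + 2 * sqrt d\<rceil>"
  have "infinite S"
    using irr rational_iff_finite_approx_set by (simp add: S_def)
  moreover have "N ` S \<subseteq> {- M .. M}"
  proof (rule image_subsetI, clarify)
    fix h k assume "(h, k) \<in> S"
    then have "\<bar>(real_of_int h)\<^sup>2 - real d * (real_of_int k)\<^sup>2\<bar> \<le> 1 + 2 * sqrt d"
      unfolding S_def by (rule norm_of_approximation_le) simp
    also have "(real_of_int h)\<^sup>2 - real d * (real_of_int k)\<^sup>2 = real_of_int (N (h, k))"
      by (simp add: N_def)
    also have "\<bar>real_of_int (N (h, k))\<bar> = real_of_int \<bar>N (h, k)\<bar>"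
      by simp
    finally have "\<bar>N (h, k)\<bar> \<le> M"
      unfolding M_def by linarith
    then show "N (h, k) \<in> {- M .. M}" by (simp add: abs_le_iff)
  qed
  then have "finite (N ` S)" by (rule finite_subset) simp
  ultimately obtain s where s: "s \<in> S" and inf: "infinite {t \<in> S. N t = N s}"
    using pigeonhole_infinite by blast
  define m where "m = N s"
  define T where "T = {t \<in> S. N t = m}"
  have T: "infinite T" using inf by (simp add: T_def m_def)
  have "m \<noteq> 0"
  proof
    obtain h k where hk: "s = (h, k)" by (cases s)
    assume "m = 0"
    then have "h\<^sup>2 = int d * k\<^sup>2" by (simp add: m_def N_def hk)
    then have "real_of_int (h\<^sup>2) = real_of_int (int d * k\<^sup>2)" by (rule arg_cong)
    then have "(real_of_int h)\<^sup>2 = real d * (real_of_int k)\<^sup>2" by simp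
    moreover have k: "k > 0" using s by (auto simp: S_def hk approx_set_def)
    ultimately have "real d = (h / k)\<^sup>2" by (simp add: power_divide)
    then have "sqrt d = \<bar>h / k\<bar>" by (simp only: real_sqrt_abs)
    then show False using irr by simp
  qed
  define R where "R = (\<lambda>(h, k). (h mod m, k mod m))"
  have "finite (R ` T)"
  proof (rule finite_subset)
    have "x mod m \<in> {- \<bar>m\<bar> .. \<bar>m\<bar>}" for x
      using abs_mod_less[OF \<open>m \<noteq> 0\<close>, of x] by (simp only: atLeastAtMost_iff) linarith
    then show "R ` T \<subseteq> {- \<bar>m\<bar> .. \<bar>m\<bar>} \<times> {- \<bar>m\<bar> .. \<bar>m\<bar>}"
      by (auto simp only: R_def split: prod.splits)
  qed simp
  then obtain t where t: "t \<in> T" and inf: "infinite {t' \<in> T. R t' = R t}"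
    using pigeonhole_infinite[OF T] by blast
  have "infinite ({t' \<in> T. R t' = R t} - {t})" using inf by simp
  then have "{t' \<in> T. R t' = R t} - {t} \<noteq> {}" by (rule infinite_imp_nonempty)
  then obtain t' where t': "t' \<in> T" "R t' = R t" "t' \<noteq> t" by blast
  obtain h k where hk: "t = (h, k)" by (cases t)
  obtain h' k' where hk': "t' = (h', k')" by (cases t')
  have n: "h\<^sup>2 - int d * k\<^sup>2 = m" "h'\<^sup>2 - int d * k'\<^sup>2 = m"
    using t t' by (simp_all add: T_def N_def hk hk')
  have c: "h' mod m = h mod m" "k' mod m = k mod m"
    using t'(2) by (simp_all add: R_def hk hk')
  have "m dvd h' - h" "m dvd k' - k"
    using c by (simp_all add: mod_eq_dvd_iff)
  then obtain u v where uv: "h' = h + m * u" "k' = k + m * v"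
    by (metis add.commute diff_add_cancel dvdE)
  \<comment> \<open>\<open>x + y \<surd>d\<close> is \<open>(h + k \<surd>d) (h' - k' \<surd>d) / m\<close>; the congruences carry out the division.\<close>
  define x where "x = 1 + u * h - int d * v * k"
  define y where "y = u * k - v * h"
  have x: "m * x = h * h' - int d * k * k'"
    unfolding x_def uv using n(1) by (simp add: power2_eq_square algebra_simps)
  have y: "m * y = h' * k - h * k'"
    unfolding y_def uv by (simp add: algebra_simps)
  have "m\<^sup>2 * (x\<^sup>2 - int d * y\<^sup>2) = (m * x)\<^sup>2 - int d * (m * y)\<^sup>2"
    by (simp add: power2_eq_square algebra_simps)
  also have "\<dots> = (h\<^sup>2 - int d * k\<^sup>2) * (h'\<^sup>2 - int d * k'\<^sup>2)"
    unfolding x y by (simp add: power2_eq_square algebra_simps)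
  also have "\<dots> = m\<^sup>2 * 1" unfolding n by (simp add: power2_eq_square)
  finally have "x\<^sup>2 - int d * y\<^sup>2 = 1" using \<open>m \<noteq> 0\<close> by simp
  moreover have "y \<noteq> 0"
  proof
    assume "y = 0"
    then have e: "h' * k = h * k'" using y by simp
    have pos: "k > 0" "k' > 0" "coprime h k" "coprime h' k'"
      using t t' by (auto simp: T_def S_def hk hk' approx_set_def)
    have "k dvd k'" "k' dvd k"
      using e pos by (metis coprime_commute coprime_dvd_mult_right_iff dvd_triv_right)+
    then have "k = k'" using pos by (simp add: zdvd_antisym_nonneg)
    then show False using e pos t'(3) by (simp add: hk hk')
  qed
  ultimately show ?thesis using that by blast
qed

section \<open>Descent on the least solution\<close>

lemma sqrt_2_mult_odd_irrational:
  assumes "odd n"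
  shows "sqrt (real (2 * n)) \<notin> \<rat>"
proof
  assume "sqrt (real (2 * n)) \<in> \<rat>"
  then obtain a b :: nat where ab: "b \<noteq> 0" "\<bar>sqrt (real (2 * n))\<bar> = a / b" "coprime a b"
    by (rule Rats_abs_nat_div_natE)
  then have "sqrt (real (2 * n)) * b = a" by simp
  then have "(sqrt (real (2 * n)))\<^sup>2 * (real b)\<^sup>2 = (real a)\<^sup>2"
    by (metis power_mult_distrib)
  then have "real (2 * n * b\<^sup>2) = real (a\<^sup>2)"
    by simp
  then have e: "2 * n * b\<^sup>2 = a\<^sup>2" by (simp only: of_nat_eq_iff)
  then have "even (a\<^sup>2)" by (metis dvd_triv_left mult.assoc)
  then have "even a" by simp
  then obtain c where "a = 2 * c" by (rule dvdE)
  with e have "n * b\<^sup>2 = 2 * c\<^sup>2" by (simp add: power2_eq_square ac_simps)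
  then have "even (n * b\<^sup>2)" by simp
  then have "even b" using assms by simp
  with \<open>even a\<close> \<open>coprime a b\<close> show False
    by (metis coprime_common_divisor_nat numeral_eq_one_iff semiring_norm(85))
qed

lemma coprime_factors_of_prime_mult:
  fixes u v q n :: nat
  assumes "prime q" "coprime u v" "u * v = q * n"
  obtains u' where "u = q * u'" "u' * v = n" "coprime u' v"
    | v' where "v = q * v'" "u * v' = n" "coprime u v'"
proof -
  have "q dvd u * v" using assms(3) by simp
  then have "q dvd u \<or> q dvd v" using assms(1) by (simp add: prime_dvd_mult_iff)
  moreover have "q \<noteq> 0" using assms(1) by auto
  ultimately show ?thesis
  proof (elim disjE dvdE)
    fix u' assume u: "u = q * u'"
    then have "q * (u' * v) = q * n" using assms(3) by (simp only: mult.assoc)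
    then have "u' * v = n" using \<open>q \<noteq> 0\<close> mult_left_cancel[of q] by blast
    with u assms(2) show ?thesis by (intro that(1)[of u']) simp_all
  next
    fix v' assume v: "v = q * v'"
    then have "q * (u * v') = q * n" using assms(3) by (simp only: mult.left_commute)
    then have "u * v' = n" using \<open>q \<noteq> 0\<close> mult_left_cancel[of q] by blast
    with v assms(2) show ?thesis by (intro that(2)[of v']) simp_all
  qed
qed

lemma coprime_factors_of_square:
  fixes u v s :: nat
  assumes "coprime u v" "u * v = s\<^sup>2" "s > 0"
  obtains a b where "u = a\<^sup>2" "v = b\<^sup>2"
proof -
  have "u * v > 0" using assms by simp
  then have "u > 0" "v > 0" by simp_all
  moreover have "is_nth_power 2 (u * v)" using assms(2) by simp
  ultimately have "is_nth_power 2 u" "is_nth_power 2 v"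
    using is_nth_power_mult_coprime_natD[OF assms(1)] by blast+
  then show ?thesis using that by (auto elim!: is_nth_powerE)
qed

lemma coprime_factors_of_2_prime_square:
  fixes u v p s :: nat
  assumes "prime p" "coprime u v" "u * v = 2 * (p * s\<^sup>2)" "s > 0"
  obtains a b where "u = 2 * p * a\<^sup>2" "v = b\<^sup>2"
    | a b where "u = a\<^sup>2" "v = 2 * p * b\<^sup>2"
    | a b where "u = 2 * a\<^sup>2" "v = p * b\<^sup>2"
    | a b where "u = p * a\<^sup>2" "v = 2 * b\<^sup>2"
  using two_is_prime_nat assms(2,3)
proof (cases rule: coprime_factors_of_prime_mult)
  case (1 u')
  from assms(1) 1(3,2) show ?thesis
  proof (cases rule: coprime_factors_of_prime_mult)
    case (1 u'')
    then obtain a b where "u'' = a\<^sup>2" "v = b\<^sup>2"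
      using coprime_factors_of_square assms(4) by blast
    then show ?thesis using 1 \<open>u = 2 * u'\<close> by (intro that(1)[of a b]) simp_all
  next
    case (2 v')
    then obtain a b where "u' = a\<^sup>2" "v' = b\<^sup>2"
      using coprime_factors_of_square assms(4) by blast
    then show ?thesis using 2 \<open>u = 2 * u'\<close> by (intro that(3)[of a b]) simp_all
  qed
next
  case (2 v')
  from assms(1) 2(3,2) show ?thesis
  proof (cases rule: coprime_factors_of_prime_mult)
    case (1 u')
    then obtain a b where "u' = a\<^sup>2" "v' = b\<^sup>2"
      using coprime_factors_of_square assms(4) by blast
    then show ?thesis using 1 \<open>v = 2 * v'\<close> by (intro that(4)[of a b]) simp_all
  next
    case (2 v'')
    then obtain a b where "u = a\<^sup>2" "v'' = b\<^sup>2"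
      using coprime_factors_of_square assms(4) by blast
    then show ?thesis using 2 \<open>v = 2 * v'\<close> by (intro that(2)[of a b]) simp_all
  qed
qed

text \<open>
  In \<open>x\<^sup>2 - 1 = 2 p y\<^sup>2\<close> with \<open>x = 2 t + 1\<close> and \<open>y = 2 s\<close>, the coprime numbers \<open>t\<close> and \<open>t + 1\<close> have
  product \<open>2 p s\<^sup>2\<close>, and so each is a square up to its share of the factor \<open>2 p\<close>. Three of the four ways
  to share are the claimed equations; the fourth is the original equation with a smaller
  \<open>y\<close>, which cannot occur for the least solution.
\<close>
theorem Pell_2_prime_trichotomy:
  fixes p :: nat
  assumes p: "prime p" "odd p"
  obtains a b :: int where "a\<^sup>2 - 2 * int p * b\<^sup>2 = -1"
    | a b :: int where "2 * a\<^sup>2 - int p * b\<^sup>2 = 1"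
    | a b :: int where "2 * a\<^sup>2 - int p * b\<^sup>2 = -1"
proof -
  define P where "P = (\<lambda>y :: nat. y > 0 \<and> (\<exists>x :: nat. x\<^sup>2 = 1 + 2 * p * y\<^sup>2))"
  obtain x\<^sub>0 y\<^sub>0 :: int where "y\<^sub>0 \<noteq> 0" "x\<^sub>0\<^sup>2 - int (2 * p) * y\<^sub>0\<^sup>2 = 1"
    by (rule Pell_nontrivial_solution[OF sqrt_2_mult_odd_irrational[OF p(2)]])
  then have "int ((nat \<bar>x\<^sub>0\<bar>)\<^sup>2) = int (1 + 2 * p * (nat \<bar>y\<^sub>0\<bar>)\<^sup>2)"
    by simp
  then have "P (nat \<bar>y\<^sub>0\<bar>)"
    unfolding P_def of_nat_eq_iff using \<open>y\<^sub>0 \<noteq> 0\<close> by auto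
  define y where "y = (LEAST y. P y)"
  have "P y" unfolding y_def by (rule LeastI) fact
  then obtain x where x: "x\<^sup>2 = 1 + 2 * p * y\<^sup>2" and "y > 0"
    by (auto simp: P_def)
  have min: "\<not> P z" if "z < y" for z
    using that unfolding y_def by (rule not_less_Least)
  have "odd (x\<^sup>2)" unfolding x by simp
  then have "odd x" by simp
  then obtain t where t: "x = 2 * t + 1" by (rule oddE)
  then have ty: "2 * (t * (t + 1)) = p * y\<^sup>2"
    using x by (simp add: power2_eq_square algebra_simps)
  then have "even (p * y\<^sup>2)" by (metis dvd_triv_left)
  then have "even y" using p by simp
  then obtain s where s: "y = 2 * s" by (rule dvdE)
  have ts: "t * (t + 1) = 2 * (p * s\<^sup>2)"
    using ty unfolding s by (simp add: power2_eq_square)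
  have "s > 0" using \<open>y > 0\<close> s by simp
  have "coprime t (t + 1)" by simp
  from p(1) this ts \<open>s > 0\<close>
  consider (one) a b where "t = 2 * p * a\<^sup>2" "t + 1 = b\<^sup>2"
    | (A) a b where "t = a\<^sup>2" "t + 1 = 2 * p * b\<^sup>2"
    | (C) a b where "t = 2 * a\<^sup>2" "t + 1 = p * b\<^sup>2"
    | (B) a b where "t = p * a\<^sup>2" "t + 1 = 2 * b\<^sup>2"
    by (rule coprime_factors_of_2_prime_square)
  then show ?thesis
  proof cases
    case (one a b)
    then have e: "b\<^sup>2 = 1 + 2 * p * a\<^sup>2" by simp
    have "a > 0" 
      using ts one(1) \<open>s > 0\<close> p by (cases "a = 0") auto
    with e have "P a" by (auto simp: P_def)
    have "2 * p * (a\<^sup>2 * b\<^sup>2) = 2 * p * s\<^sup>2"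
      using ts one by (metis mult.assoc)
    then have "a\<^sup>2 * b\<^sup>2 = s\<^sup>2" using p by auto
    moreover have "b\<^sup>2 \<ge> 1" using e by simp
    ultimately have "a\<^sup>2 \<le> s\<^sup>2" by (metis mult_le_mono2 mult_1_right)
    then have "a < y" using \<open>s > 0\<close> s by simp
    with \<open>P a\<close> min show ?thesis by blast
  next
    case (A a b)
    then have "int (a\<^sup>2 + 1) = int (2 * p * b\<^sup>2)" by simp
    then have "(int a)\<^sup>2 - 2 * int p * (int b)\<^sup>2 = -1" by simp
    then show ?thesis by (rule that(1))
  next
    case (C a b)
    then have "int (2 * a\<^sup>2 + 1) = int (p * b\<^sup>2)" by simp
    then have "2 * (int a)\<^sup>2 - int p * (int b)\<^sup>2 = -1" by simp
    then show ?thesis by (rule that(3))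
  next
    case (B a b)
    then have "int (p * a\<^sup>2 + 1) = int (2 * b\<^sup>2)" by simp
    then have "2 * (int b)\<^sup>2 - int p * (int a)\<^sup>2 = 1" by simp
    then show ?thesis by (rule that(2))
  qed
qed

section \<open>The Legendre symbol\<close>

lemma Legendre_cases: "Legendre a p = 0 \<or> Legendre a p = 1 \<or> Legendre a p = -1"
  by (auto simp: Legendre_def)

lemma Legendre_cong:
  assumes "[a = b] (mod p)"
  shows "Legendre a p = Legendre b p"
  using assms by (simp add: Legendre_def QuadRes_def unique_euclidean_semiring_class.cong_def)

lemma abs_Legendre_le_1: "\<bar>Legendre a p\<bar> \<le> 1"
  by (simp add: Legendre_def)

lemma Legendre_eq_if_cong:
  fixes p :: nat
  assumes "2 < p" "\<bar>e\<bar> \<le> 1" "[Legendre a p = e] (mod int p)"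
  shows "Legendre a p = e"
proof (rule ccontr)
  assume "Legendre a p \<noteq> e"
  moreover have "int p dvd Legendre a p - e"
    using assms(3) by (simp add: cong_iff_dvd_diff)
  ultimately have "\<bar>int p\<bar> \<le> \<bar>Legendre a p - e\<bar>"
    by (intro dvd_imp_le_int) simp_all
  then show False
    using assms(1,2) abs_Legendre_le_1[of a p] by linarith
qed

lemma Legendre_mult:
  fixes p :: nat
  assumes "prime p" "2 < p"
  shows "Legendre (a * b) p = Legendre a p * Legendre b p"
proof (rule Legendre_eq_if_cong)
  let ?k = "(p - 1) div 2"
  have "[Legendre (a * b) p = (a * b) ^ ?k] (mod int p)"
    by (rule euler_criterion[OF assms])
  also have "(a * b) ^ ?k = a ^ ?k * b ^ ?k"
    by (rule power_mult_distrib)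
  also have "[a ^ ?k * b ^ ?k = Legendre a p * Legendre b p] (mod int p)"
    by (intro cong_mult cong_sym[OF euler_criterion[OF assms]])
  finally show "[Legendre (a * b) p = Legendre a p * Legendre b p] (mod int p)" .
  show "\<bar>Legendre a p * Legendre b p\<bar> \<le> 1"
    unfolding abs_mult by (intro mult_le_one abs_Legendre_le_1 abs_ge_zero)
qed (rule assms)

lemma Legendre_square:
  assumes "prime p" "\<not> p dvd z"
  shows "Legendre (z\<^sup>2) p = 1"
proof -
  have "\<not> [z\<^sup>2 = 0] (mod p)"
    using assms by (simp add: cong_0_iff prime_dvd_power_iff)
  moreover have "QuadRes p (z\<^sup>2)"
    unfolding QuadRes_def by (rule exI[of _ z]) (rule cong_refl)
  ultimately show ?thesis by (simp add: Legendre_def)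
qed

lemma Legendre_1: "prime p \<Longrightarrow> Legendre 1 p = 1"
  using Legendre_square[of p 1] by (metis not_prime_unit one_power2)

lemma prime_gt_2_if_1_mod_8:
  fixes p :: nat
  assumes "prime p" "p mod 8 = 1"
  shows "2 < p"
  using assms prime_gt_1_nat[of p] by (cases "p = 2") auto

lemma eq_if_1_mod_8:
  fixes p :: nat
  assumes "p mod 8 = 1"
  obtains n where "p = 8 * n + 1"
proof
  show "p = 8 * (p div 8) + 1"
    using div_mult_mod_eq[of p 8] assms by linarith
qed

lemma Legendre_minus_1:
  fixes p :: nat
  assumes "prime p" "p mod 8 = 1"
  shows "Legendre (-1) p = 1"
proof (rule Legendre_eq_if_cong)
  show p2: "2 < p" by (rule prime_gt_2_if_1_mod_8[OF assms])
  obtain n where "p = 8 * n + 1" by (rule eq_if_1_mod_8[OF assms(2)])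
  then have "(p - 1) div 2 = 2 * (2 * n)" by simp
  then have e: "(- 1) ^ ((p - 1) div 2) = (1 :: int)"
    by (simp only: power_mult power2_minus one_power2 power_one)
  show "[Legendre (-1) p = 1] (mod int p)"
    using euler_criterion[OF assms(1) p2, of "-1"] unfolding e .
qed simp

text \<open>
  Gauss's lemma for the multiplier \<open>2\<close>: the doubles \<open>2, 4, \<dots>, p - 1\<close> are already reduced,
  so the sign counts those of them beyond \<open>p/2\<close>.
\<close>
lemma Legendre_2:
  fixes p :: nat
  assumes "prime p" "2 < p"
  shows "Legendre 2 p = (if p mod 8 = 1 \<or> p mod 8 = 7 then 1 else -1)"
proof -
  have op: "odd p" using assms by (simp add: prime_odd_nat)
  interpret GAUSS p 2
    using assms zdvd_not_zless[of 2 "int p"] by unfold_locales (simp_all add: cong_0_iff)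
  define h where "h = (int p - 1) div 2"
  have p: "int p = 2 * h + 1" using p_eq2 by (simp add: h_def)
  have A: "A = {0 <.. h}" by (simp add: A_def h_def)
  have "C = (\<lambda>y. y * 2) ` {0 <.. h}"
    unfolding C_def B_def A image_image
  proof (rule image_cong[OF refl])
    fix y assume "y \<in> {0 <.. h}"
    then have "0 \<le> y * 2" "y * 2 < int p" using p by simp_all
    then show "y * 2 mod int p = y * 2" by (rule mod_pos_pos_trivial)
  qed
  moreover have "h < y * 2 \<longleftrightarrow> h div 2 < y" for y by linarith
  moreover have "0 < y" if "h div 2 < y" for y using that p by linarith
  ultimately have "E = (\<lambda>y. y * 2) ` {h div 2 <.. h}"
    unfolding E_def h_def[symmetric] by (force simp: image_iff)
  then have "card E = nat (h - h div 2)"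
    by (simp add: card_image inj_on_def)
  then have L: "Legendre 2 p = (-1) ^ nat (h - h div 2)"
    using gauss_lemma by simp
  define m where "m = h div 4"
  define r where "r = h mod 4"
  have h: "h = 4 * m + r" by (simp add: m_def r_def)
  have "h \<ge> 0" using p assms by linarith
  then have "m \<ge> 0" by (simp add: m_def)
  have "r = 0 \<or> r = 1 \<or> r = 2 \<or> r = 3" unfolding r_def by presburger
  then have "even (nat (h - h div 2)) \<longleftrightarrow> p mod 8 = 1 \<or> p mod 8 = 7"
  proof (elim disjE)
    assume "r = 0"
    then have "h - h div 2 = 2 * m" "p mod 8 = 1" using h p by presburger+
    then show ?thesis using \<open>m \<ge> 0\<close> by (simp add: even_nat_iff)
  next
    assume "r = 1"
    then have "h - h div 2 = 2 * m + 1" "p mod 8 = 3" using h p by presburger+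
    then show ?thesis using \<open>m \<ge> 0\<close> by (simp add: even_nat_iff)
  next
    assume "r = 2"
    then have "h - h div 2 = 2 * m + 1" "p mod 8 = 5" using h p by presburger+
    then show ?thesis using \<open>m \<ge> 0\<close> by (simp add: even_nat_iff)
  next
    assume "r = 3"
    then have "h - h div 2 = 2 * m + 2" "p mod 8 = 7" using h p by presburger+
    then show ?thesis using \<open>m \<ge> 0\<close> by (simp add: even_nat_iff)
  qed
  then show ?thesis by (simp add: L)
qed

text \<open>
  As \<open>p \<equiv> 1 (mod 8)\<close>, the symbol is \<open>1\<close> at \<open>-1\<close> and at \<open>2\<close>, and reciprocity with an odd prime has no
  sign. So the sign and the power of \<open>2\<close> in \<open>u\<close> are harmless, and the odd prime factors can be inverted
  one at a time; this replaces the Jacobi symbol.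
\<close>
lemma Legendre_eq_1_if_prime_factors:
  fixes p :: nat and u :: int
  assumes p: "prime p" "p mod 8 = 1" and "u \<noteq> 0"
    and "\<And>q :: nat. prime q \<Longrightarrow> 2 < q \<Longrightarrow> int q dvd u \<Longrightarrow> Legendre p q = 1"
  shows "Legendre u p = 1"
proof -
  have p2: "2 < p" by (rule prime_gt_2_if_1_mod_8[OF p])
  show ?thesis using assms(3,4)
  proof (induction u rule: prime_divisors_induct)
    case zero
    then show ?case by simp
  next
    case (unit u)
    then have "u = 1 \<or> u = -1"
      by (auto simp: abs_if split: if_splits)
    then show ?case
      using p by (auto simp: Legendre_1 Legendre_minus_1)
  next
    case (factor q u)
    have IH: "Legendre u p = 1"
      by (rule factor.IH) (use factor.prems in auto)
    define r where "r = nat q"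
    have r: "q = int r" "prime r"
      using factor.hyps by (auto simp: r_def prime_ge_0_int)
    have "Legendre q p = 1"
    proof (cases "r = 2")
      case True
      then show ?thesis using r Legendre_2[OF p(1) p2] p(2) by simp
    next
      case False
      then have r2: "2 < r" using prime_ge_2_nat[OF r(2)] by simp
      have pr: "Legendre p r = 1"
        using factor.prems(2)[of r] r r2 by simp
      then have "p \<noteq> r" by (auto simp: Legendre_def cong_0_iff)
      obtain n where "p = 8 * n + 1" by (rule eq_if_1_mod_8[OF p(2)])
      then have "even ((r - 1) div 2 * ((p - 1) div 2))" by simp
      then show ?thesis
        using Quadratic_Reciprocity[OF r(2) r2 p(1) p2] \<open>p \<noteq> r\<close> pr r by simp
    qed
    then show ?case
      using IH Legendre_mult[OF p(1) p2, of q u] by simp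
  qed
qed

text \<open>
  At a prime \<open>q\<close> dividing \<open>u\<close>, coprimality keeps \<open>z\<close> invertible, so \<open>p b\<^sup>2 \<equiv> z\<^sup>2 (mod q)\<close> exhibits \<open>p\<close>
  as a nonzero square modulo \<open>q\<close>.
\<close>
lemma Legendre_divisor_eq_1:
  fixes p :: nat and u b z :: int
  assumes p: "prime p" "p mod 8 = 1" and u: "u \<noteq> 0" "u dvd int p * b\<^sup>2 - z\<^sup>2" "coprime u z"
  shows "Legendre u p = 1"
proof (rule Legendre_eq_1_if_prime_factors[OF p u(1)])
  fix q :: nat
  assume q: "prime q" "2 < q" "int q dvd u"
  then have "\<not> int q dvd z"
    using u(3) by (metis coprime_common_divisor not_prime_unit prime_nat_int_transfer)
  then have "Legendre (z\<^sup>2) q = 1"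
    using q by (intro Legendre_square) auto
  moreover have "[int p * b\<^sup>2 = z\<^sup>2] (mod int q)"
    using q(3) u(2) by (meson cong_iff_dvd_diff dvd_trans)
  ultimately have "Legendre p q * (Legendre b q * Legendre b q) = 1"
    using q(1,2) by (metis Legendre_cong Legendre_mult power2_eq_square)
  then show "Legendre p q = 1"
    using Legendre_cases[of b q] by auto
qed

text \<open>
  The equation \<open>2 a\<^sup>2 \<equiv> 1\<close> makes \<open>2\<close> a square modulo every prime factor of \<open>b\<close>. These primes are thus
  \<open>\<plusminus>1\<close> modulo \<open>8\<close>, a property that is inherited by their products.
\<close>
lemma square_mod_16_if_2_residue:
  fixes b :: int
  assumes "odd b" "b dvd 2 * a\<^sup>2 - 1"
  shows "b\<^sup>2 mod 16 = 1"
proof -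
  have "b mod 8 = 1 \<or> b mod 8 = 7" using assms
  proof (induction b rule: prime_divisors_induct)
    case zero
    then show ?case by simp
  next
    case (unit b)
    then have "b = 1 \<or> b = -1"
      by (auto simp: abs_if split: if_splits)
    then show ?case by auto
  next
    case (factor q b)
    have IH: "b mod 8 = 1 \<or> b mod 8 = 7"
      by (rule factor.IH) (use factor.prems in \<open>auto dest: dvd_mult_right\<close>)
    define r where "r = nat q"
    have r: "q = int r" "prime r"
      using factor.hyps by (auto simp: r_def prime_ge_0_int)
    have "odd r" using factor.prems r by auto
    then have r2: "2 < r" using prime_ge_2_nat[OF r(2)] by (cases "r = 2") auto
    have "int r dvd 2 * a\<^sup>2 - 1"
      using factor.prems r by (meson dvd_mult_left)
    then have c: "[2 * a\<^sup>2 = 1] (mod int r)"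
      by (simp add: cong_iff_dvd_diff)
    have "Legendre 2 r * (Legendre a r * Legendre a r) = Legendre (2 * a\<^sup>2) r"
      by (simp add: Legendre_mult[OF r(2) r2] power2_eq_square)
    also have "\<dots> = 1"
      using Legendre_cong[OF c] Legendre_1[of "int r"] r by simp
    finally have "Legendre 2 r \<noteq> -1"
      using Legendre_cases[of a r] by auto
    then have "r mod 8 = 1 \<or> r mod 8 = 7"
      using Legendre_2[OF r(2) r2] by metis
    then have "q mod 8 = 1 \<or> q mod 8 = 7"
      unfolding r by presburger
    moreover have "(q * b) mod 8 = ((q mod 8) * (b mod 8)) mod 8"
      by (simp add: mod_mult_eq)
    ultimately show ?case using IH by auto
  qed
  moreover have "b = 8 * (b div 8) + b mod 8" by simp
  ultimately have "\<exists>m. b\<^sup>2 = 16 * m + 1"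
  proof (elim disjE)
    assume "b mod 8 = 1" "b = 8 * (b div 8) + b mod 8"
    then obtain k where b: "b = 8 * k + 1" by metis
    have "b\<^sup>2 = 16 * (4 * k\<^sup>2 + k) + 1"
      unfolding b by (simp add: power2_eq_square algebra_simps)
    then show ?thesis by blast
  next
    assume "b mod 8 = 7" "b = 8 * (b div 8) + b mod 8"
    then obtain k where b: "b = 8 * k + 7" by metis
    have "b\<^sup>2 = 16 * (4 * k\<^sup>2 + 7 * k + 3) + 1"
      unfolding b by (simp add: power2_eq_square algebra_simps)
    then show ?thesis by blast
  qed
  then show ?thesis by auto
qed

section \<open>The quartic symbol\<close>

text \<open>
  Euler's criterion for fourth powers, by applying the quadratic criterion twice: if \<open>s\<^sup>2 \<equiv> 2\<close>, then
  \<open>2\<^bsup>(p-1)/4\<^esup> \<equiv> (s/p)\<close>, and \<open>s \<equiv> w\<^sup>2\<close> gives \<open>2 \<equiv> w\<^sup>4\<close>.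
\<close>
lemma quartic_symbol_2_eq_1:
  fixes p :: nat
  assumes p: "prime p" "p mod 8 = 1" and "[2 ^ ((p - 1) div 4) = 1] (mod int p)"
  shows "quartic_symbol_2 p = 1"
proof -
  have p2: "2 < p" by (rule prime_gt_2_if_1_mod_8[OF p])
  have "Legendre 2 p = 1" using Legendre_2[OF p(1) p2] p(2) by simp
  then obtain s where s: "[s\<^sup>2 = 2] (mod int p)"
    by (auto simp: Legendre_def QuadRes_def split: if_splits)
  obtain n where n: "p = 8 * n + 1" by (rule eq_if_1_mod_8[OF p(2)])
  then have "(p - 1) div 2 = 2 * ((p - 1) div 4)" by simp
  then have "s ^ ((p - 1) div 2) = (s\<^sup>2) ^ ((p - 1) div 4)"
    by (simp add: power_mult)
  with euler_criterion[OF p(1) p2, of s]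
  have "[Legendre s p = (s\<^sup>2) ^ ((p - 1) div 4)] (mod int p)" by simp
  also have "[(s\<^sup>2) ^ ((p - 1) div 4) = 2 ^ ((p - 1) div 4)] (mod int p)"
    by (rule cong_pow[OF s])
  also note assms(3)
  finally have "Legendre s p = 1"
    by (intro Legendre_eq_if_cong[OF p2]) simp_all
  then obtain w where "[w\<^sup>2 = s] (mod int p)"
    by (auto simp: Legendre_def QuadRes_def split: if_splits)
  then have "[(w\<^sup>2)\<^sup>2 = s\<^sup>2] (mod int p)"
    by (rule cong_pow)
  then have "[w ^ 4 = 2] (mod int p)"
    using s cong_trans by (fastforce simp flip: power_mult)
  then show ?thesis by (auto simp: quartic_symbol_2_def)
qed

lemma power_if_quartic_symbol_2:
  fixes p :: nat
  assumes p: "prime p" "p mod 8 = 1" and "quartic_symbol_2 p = 1"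
  shows "[2 ^ ((p - 1) div 4) = 1] (mod int p)"
proof -
  have p2: "2 < p" by (rule prime_gt_2_if_1_mod_8[OF p])
  obtain w :: int where w: "[w ^ 4 = 2] (mod int p)"
    using assms(3) by (auto simp: quartic_symbol_2_def split: if_splits)
  have "\<not> int p dvd 2" using p2 by (auto dest: zdvd_imp_le)
  then have nd: "\<not> int p dvd w"
    using w by (metis cong_dvd_iff dvd_power dvd_trans zero_less_numeral)
  have "[2 ^ ((p - 1) div 4) = (w ^ 4) ^ ((p - 1) div 4)] (mod int p)"
    by (rule cong_pow[OF cong_sym[OF w]])
  also have "(w ^ 4) ^ ((p - 1) div 4) = (w\<^sup>2) ^ ((p - 1) div 2)"
  proof -
    obtain n where "p = 8 * n + 1" by (rule eq_if_1_mod_8[OF p(2)])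
    then have "4 * ((p - 1) div 4) = 2 * ((p - 1) div 2)" by simp
    then show ?thesis by (metis power_mult)
  qed
  also have "[(w\<^sup>2) ^ ((p - 1) div 2) = Legendre (w\<^sup>2) p] (mod int p)"
    by (rule cong_sym[OF euler_criterion[OF p(1) p2]])
  also have "Legendre (w\<^sup>2) p = 1"
    by (rule Legendre_square) (use p nd in auto)
  finally show ?thesis .
qed

lemma quartic_symbol_2_eq_1_iff:
  fixes p :: nat
  assumes "prime p" "p mod 8 = 1"
  shows "quartic_symbol_2 p = 1 \<longleftrightarrow> [2 ^ ((p - 1) div 4) = 1] (mod int p)"
  using quartic_symbol_2_eq_1[OF assms] power_if_quartic_symbol_2[OF assms] by blast

section \<open>Necessary conditions for solvability\<close>

text \<open>
  Write \<open>a = 2 v + 1\<close>. The equation becomes \<open>p b\<^sup>2 = (v + 1)\<^sup>2 + v\<^sup>2\<close>, so the symbol of \<open>v + 1\<close>, and with it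
  that of \<open>a + 1 = 2 (v + 1)\<close>, is \<open>1\<close>. Combine this with the congruence \<open>(a + 1)\<^sup>2 \<equiv> 2 a (mod p)\<close>.
\<close>
lemma power_of_2_if_norm_minus_1:
  fixes p :: nat and a b :: int
  assumes p: "prime p" "p mod 8 = 1" and e: "a\<^sup>2 - 2 * int p * b\<^sup>2 = -1"
  shows "[2 ^ ((p - 1) div 4) = (-1) ^ ((p - 1) div 8)] (mod int p)"
proof -
  let ?k = "(p - 1) div 4"
  have p2: "2 < p" by (rule prime_gt_2_if_1_mod_8[OF p])
  have "a\<^sup>2 = 2 * (int p * b\<^sup>2) - 1" using e by linarith
  then have "odd (a\<^sup>2)" by simp
  then have "odd a" by simp
  then obtain v where a: "a = 2 * v + 1" by (auto elim: oddE)
  have uv: "int p * b\<^sup>2 - v\<^sup>2 = (v + 1)\<^sup>2"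
    using e unfolding a by (simp add: power2_eq_square algebra_simps)
  have "v + 1 \<noteq> 0"
  proof
    assume "v + 1 = 0"
    then have "v = -1" by simp
    with uv have "int p * b\<^sup>2 = 1" by simp
    then show False using p2 by (simp add: zmult_eq_1_iff)
  qed
  moreover have "v + 1 dvd int p * b\<^sup>2 - v\<^sup>2" unfolding uv by simp
  moreover have "coprime (v + 1) v"
    by simp
  ultimately have "Legendre (v + 1) p = 1"
    using Legendre_divisor_eq_1[OF p] by blast
  moreover have "Legendre 2 p = 1" using Legendre_2[OF p(1) p2] p(2) by simp
  moreover have a1: "a + 1 = 2 * (v + 1)" using a by simp
  ultimately have L: "Legendre (a + 1) p = 1"
    using Legendre_mult[OF p(1) p2] by (metis mult_1)
  have a2: "[a\<^sup>2 = -1] (mod int p)"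
    using e by (auto simp: cong_iff_dvd_diff intro!: dvdI[of _ _ "2 * b\<^sup>2"])
  obtain n where "p = 8 * n + 1" by (rule eq_if_1_mod_8[OF p(2)])
  then have k: "(p - 1) div 2 = 2 * ?k" "?k = 2 * ((p - 1) div 8)" by simp_all
  have "[(a + 1)\<^sup>2 = 2 * a] (mod int p)"
    using a2 by (simp add: cong_iff_dvd_diff power2_eq_square algebra_simps)
  then have "[((a + 1)\<^sup>2) ^ ?k = (2 * a) ^ ?k] (mod int p)"
    by (rule cong_pow)
  moreover have "[1 = (a + 1) ^ ((p - 1) div 2)] (mod int p)"
    using euler_criterion[OF p(1) p2, of "a + 1"] L by simp
  ultimately have "[1 = (2 * a) ^ ?k] (mod int p)"
    unfolding k(1) power_mult by (rule cong_trans[rotated])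
  also have "(2 * a) ^ ?k = 2 ^ ?k * (a\<^sup>2) ^ ((p - 1) div 8)"
    using k(2) by (metis power_mult power_mult_distrib)
  also have "[2 ^ ?k * (a\<^sup>2) ^ ((p - 1) div 8) = 2 ^ ?k * (-1) ^ ((p - 1) div 8)] (mod int p)"
    by (intro cong_mult cong_pow a2 cong_refl)
  finally have "[1 * (-1) ^ ((p - 1) div 8) =
      2 ^ ?k * (-1) ^ ((p - 1) div 8) * (-1) ^ ((p - 1) div 8)] (mod int p)"
    by (rule cong_scalar_right)
  then show ?thesis
    by (simp add: cong_sym_eq mult.assoc flip: power_mult_distrib)
qed

lemma quartic_symbol_2_if_norm_minus_1:
  fixes p :: nat and a b :: int
  assumes p: "prime p" "p mod 8 = 1" and e: "a\<^sup>2 - 2 * int p * b\<^sup>2 = -1"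
  shows "quartic_symbol_2 p = (-1) ^ ((p - 1) div 8)"
proof (cases "even ((p - 1) div 8)")
  case True
  then show ?thesis
    using power_of_2_if_norm_minus_1[OF assms] quartic_symbol_2_eq_1_iff[OF p] by simp
next
  case False
  then have m: "[2 ^ ((p - 1) div 4) = -1] (mod int p)"
    using power_of_2_if_norm_minus_1[OF assms] by simp
  have "quartic_symbol_2 p \<noteq> 1"
  proof
    assume "quartic_symbol_2 p = 1"
    then have "[2 ^ ((p - 1) div 4) = 1] (mod int p)"
      using quartic_symbol_2_eq_1_iff[OF p] by simp
    with m have "[-1 = 1] (mod int p)" by (metis cong_sym cong_trans)
    then have "int p dvd 2" by (simp add: cong_iff_dvd_diff)
    then show False
      using prime_gt_2_if_1_mod_8[OF p] zdvd_imp_le[of "int p" 2] by linarith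
  qed
  then show ?thesis
    using False by (simp add: quartic_symbol_2_def split: if_splits)
qed

text \<open>
  With \<open>b\<^sup>2 \<equiv> 1 (mod 16)\<close> the equation reads \<open>p \<equiv> 2 a\<^sup>2 - 1 (mod 16)\<close>. Writing \<open>p = 8 n + 1\<close> and
  \<open>b\<^sup>2 = 16 m + 1\<close> shows that \<open>a\<close> is odd, and then that \<open>n\<close> is even.
\<close>
lemma mod_16_if_norm_2:
  fixes p :: nat and a b :: int
  assumes p: "p mod 8 = 1" and e: "2 * a\<^sup>2 - int p * b\<^sup>2 = 1"
  shows "p mod 16 = 1"
proof -
  have "int p * b\<^sup>2 = 2 * a\<^sup>2 - 1" using e by linarith
  then have "odd (int p * b\<^sup>2)" by simp
  then have "odd b" by simp
  moreover have "b dvd 2 * a\<^sup>2 - 1"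
  proof
    show "2 * a\<^sup>2 - 1 = b * (int p * b)"
      using e by (simp add: power2_eq_square algebra_simps)
  qed
  ultimately have b: "b\<^sup>2 mod 16 = 1"
    by (rule square_mod_16_if_2_residue)
  then obtain m where m: "b\<^sup>2 = 16 * m + 1"
    by (metis div_mult_mod_eq mult.commute)
  obtain n' where "p = 8 * n' + 1" by (rule eq_if_1_mod_8[OF p])
  then obtain n where n: "int p = 8 * n + 1" by (metis of_nat_1 of_nat_add of_nat_mult of_nat_numeral)
  have e2: "2 * a\<^sup>2 = 1 + (8 * n + 1) * (16 * m + 1)"
    using e m n by simp
  then have e3: "a\<^sup>2 = 1 + 4 * n + 8 * m + 64 * (n * m)"
    by (simp add: algebra_simps)
  then have "odd (a\<^sup>2)" by simp
  then have "odd a" by simp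
  then obtain t where "a = 2 * t + 1" by (auto elim: oddE)
  then have a2: "a\<^sup>2 = 4 * (t * (t + 1)) + 1"
    by (simp add: power2_eq_square algebra_simps)
  have "even (t * (t + 1))" by simp
  then obtain r where "t * (t + 1) = 2 * r" by (rule dvdE)
  then have "4 * (2 * r) + 1 = 1 + 4 * n + 8 * m + 64 * (n * m)"
    using a2 e3 by simp
  then have "n = 2 * (r - m - 8 * (n * m))" by simp
  then obtain j where "n = 2 * j" by blast
  then have "int p = 16 * j + 1" using n by simp
  then show ?thesis by presburger
qed

text \<open>
  Both \<open>a\<close>, as a divisor of \<open>p b\<^sup>2 - 1\<close>, and \<open>-1\<close>, as \<open>(p-1)/4\<close> is even, contribute the factor \<open>1\<close> when
  \<open>2 a\<^sup>2 \<equiv> -1 (mod p)\<close> is raised to the power \<open>(p-1)/4\<close>.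
\<close>
lemma quartic_symbol_2_if_norm_minus_2:
  fixes p :: nat and a b :: int
  assumes p: "prime p" "p mod 8 = 1" and e: "2 * a\<^sup>2 - int p * b\<^sup>2 = -1"
  shows "quartic_symbol_2 p = 1"
proof -
  let ?k = "(p - 1) div 4"
  have p2: "2 < p" by (rule prime_gt_2_if_1_mod_8[OF p])
  have "a \<noteq> 0"
  proof
    assume "a = 0"
    then have "int p * b\<^sup>2 = 1" using e by simp
    then show False using p2 by (simp add: zmult_eq_1_iff)
  qed
  moreover have "a dvd int p * b\<^sup>2 - 1\<^sup>2"
  proof
    show "int p * b\<^sup>2 - 1\<^sup>2 = a * (2 * a)"
      using e by (simp add: power2_eq_square algebra_simps)
  qed
  ultimately have "Legendre a p = 1"
    by (rule Legendre_divisor_eq_1[OF p]) simp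
  moreover obtain n where n: "p = 8 * n + 1" by (rule eq_if_1_mod_8[OF p(2)])
  then have k: "(p - 1) div 2 = 2 * ?k" "even ?k" by simp_all
  ultimately have L: "[1 = a ^ (2 * ?k)] (mod int p)"
    using euler_criterion[OF p(1) p2, of a] by simp
  have "[2 * a\<^sup>2 = -1] (mod int p)"
    using e by (auto simp: cong_iff_dvd_diff intro!: dvdI[of _ _ "b\<^sup>2"])
  then have "[(2 * a\<^sup>2) ^ ?k = (-1) ^ ?k] (mod int p)"
    by (rule cong_pow)
  then have "[2 ^ ?k * a ^ (2 * ?k) = 1] (mod int p)"
    using k(2) by (simp add: power_mult_distrib power_mult)
  with cong_scalar_left[OF L, of "2 ^ ?k"]
  have "[2 ^ ?k * 1 = 1] (mod int p)" by (rule cong_trans)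
  then show ?thesis by (simp add: quartic_symbol_2_eq_1_iff[OF p])
qed

section \<open>Solvability\<close>

theorem corollary3p5:
  fixes p :: nat
  assumes "prime p" and "odd p"
  shows "([p = 9] (mod 16) \<longrightarrow>
            (quartic_symbol_2 p = -1 \<longrightarrow> (\<exists>x y :: int. x ^ 2 - 2 * int p * y ^ 2 = -1)) \<and>
            (quartic_symbol_2 p = 1 \<longrightarrow> (\<exists>x y :: int. x ^ 2 - 2 * int p * y ^ 2 = -2))) \<and>
         ([p = 1] (mod 16) \<longrightarrow>
            (quartic_symbol_2 p = -1 \<longrightarrow> (\<exists>x y :: int. x ^ 2 - 2 * int p * y ^ 2 = 2)))"
proof -
  let ?s = "quartic_symbol_2 p"
  have trichotomy: "(\<exists>x y :: int. x\<^sup>2 - 2 * int p * y\<^sup>2 = -1) \<and> ?s = (-1) ^ ((p - 1) div 8) \<or>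
      (\<exists>x y :: int. x\<^sup>2 - 2 * int p * y\<^sup>2 = 2) \<and> p mod 16 = 1 \<or>
      (\<exists>x y :: int. x\<^sup>2 - 2 * int p * y\<^sup>2 = -2) \<and> ?s = 1"
    if p: "p mod 8 = 1"
    using assms
  proof (cases rule: Pell_2_prime_trichotomy)
    case (1 a b)
    then show ?thesis
      using quartic_symbol_2_if_norm_minus_1[OF assms(1) p] by blast
  next
    case (2 a b)
    then have "(2 * a)\<^sup>2 - 2 * int p * b\<^sup>2 = 2" by (simp add: power_mult_distrib)
    then show ?thesis
      using mod_16_if_norm_2[OF p 2] by blast
  next
    case (3 a b)
    then have "(2 * a)\<^sup>2 - 2 * int p * b\<^sup>2 = -2" by (simp add: power_mult_distrib)
    then show ?thesis
      using quartic_symbol_2_if_norm_minus_2[OF assms(1) p 3] by blast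
  qed
  have "p mod 8 = 1 \<and> ((-1) ^ ((p - 1) div 8) = (-1 :: int)) \<and> p mod 16 \<noteq> 1"
    if "[p = 9] (mod 16)"
  proof -
    have "p mod 16 = 9" using that by (simp add: unique_euclidean_semiring_class.cong_def)
    then have "p mod 8 = 1" by presburger
    have "p = 16 * (p div 16) + 9" using div_mult_mod_eq[of p 16] \<open>p mod 16 = 9\<close> by linarith
    then obtain n where "p = 16 * n + 9" by blast
    moreover have "(16 * n + 8) div 8 = 2 * n + 1" by simp
    ultimately show ?thesis using \<open>p mod 8 = 1\<close> by simp
  qed
  moreover have "p mod 8 = 1 \<and> ((-1) ^ ((p - 1) div 8) = (1 :: int))"
    if "[p = 1] (mod 16)"
  proof -
    have "p mod 16 = 1" using that by (simp add: unique_euclidean_semiring_class.cong_def)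
    then have "p mod 8 = 1" by presburger
    have "p = 16 * (p div 16) + 1" using div_mult_mod_eq[of p 16] \<open>p mod 16 = 1\<close> by linarith
    then obtain n where "p = 16 * n + 1" by blast
    moreover have "(16 * n) div 8 = 2 * n" by simp
    ultimately show ?thesis using \<open>p mod 8 = 1\<close> by simp
  qed
  moreover have "(1 :: int) \<noteq> -1" by simp
  ultimately show ?thesis using trichotomy by metis
qed

end
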